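(* Let $\alpha \geq 1$ and $0 \leq \beta < \alpha$ be integers, let $C(q)$ be a formal power series with $C(0) \neq 0$, and let $\gamma$ be an arithmetic function with $\gamma(1) \neq 0$; put $\widetilde{\gamma}(n) := \sum_{d|n} \gamma(d)$. Define the lower-triangular matrix $(s^{(-1)}_{n,k})_{n,k \geq 1}$ by \[ s_{n,k}^{(-1)} := \sum_{d|n} \left([q^{d-k}] \frac{1}{C(q)}\right) \gamma(n/d), \] and let $(s_{n,k})_{n,k\ge 1}$ be its inverse matrix. For a sequence $(a_n)_{n \geq 1}$, let $(\bar{a}_n)_{n \geq 1}$ be the unique sequence such that \[ \sum_{n \geq 1} \frac{a_n q^{\alpha n+\beta}}{1-q^{\alpha n+\beta}} = \frac{1}{C(q)} \sum_{n \geq 1} \sum_{k=1}^n s_{n,k}\, \bar{a}_k\, q^n . \] Then for all $n \geq 1$, \[ \bar{a}_n = \sum_{\substack{d|n,\ d > \beta \\ d \equiv \beta \bmod \alpha}} a_{\frac{d-\beta}{\alpha}}\, \widetilde{\gamma}(n/d). \]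
   Context: $[q^m] F(q)$ denotes the coefficient of $q^m$ in the power series $F(q)$, taken to be $0$ for $m<0$. An arithmetic function is a function $\mathbb{Z}_{\geq 1} \to \mathbb{C}$. All identities are of formal power series in $q$. *)

theory Defs
  imports Complex_Main
    "HOL-Computational_Algebra.Formal_Power_Series"
    "HOL-Number_Theory.Cong"
begin

text \<open>
  Sequences and infinite matrices indexed by the positive integers are functions on
  \<^typ>\<open>nat\<close> whose values at index 0 carry no information.
\<close>

definition qcoeff :: "int \<Rightarrow> complex fps \<Rightarrow> complex" where
  "qcoeff m F = (if m < 0 then 0 else fps_nth F (nat m))"

definition divisor_sum :: "(nat \<Rightarrow> complex) \<Rightarrow> nat \<Rightarrow> complex" where
  "divisor_sum \<gamma> n = (\<Sum>d | d dvd n. \<gamma> d)"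

definition s_inv :: "complex fps \<Rightarrow> (nat \<Rightarrow> complex) \<Rightarrow> nat \<Rightarrow> nat \<Rightarrow> complex" where
  "s_inv C \<gamma> n k = (\<Sum>d | d dvd n. qcoeff (int d - int k) (inverse C) * \<gamma> (n div d))"

definition lower_triangular :: "(nat \<Rightarrow> nat \<Rightarrow> complex) \<Rightarrow> bool" where
  "lower_triangular M \<longleftrightarrow> (\<forall>n\<ge>1. \<forall>k>n. M n k = 0)"

text \<open>
  Two-sided inverse among lower-triangular matrices: since both factors are lower
  triangular, the sum over all \<open>j \<ge> 1\<close> defining an entry of row \<open>n\<close> of a product
  reduces to \<open>1 \<le> j \<le> n\<close>.
\<close>

definition inverse_lt_matrix ::
    "(nat \<Rightarrow> nat \<Rightarrow> complex) \<Rightarrow> (nat \<Rightarrow> nat \<Rightarrow> complex) \<Rightarrow> bool" where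
  "inverse_lt_matrix M S \<longleftrightarrow>
     lower_triangular M \<and> lower_triangular S \<and>
     (\<forall>n\<ge>1. \<forall>k\<ge>1. (\<Sum>j=1..n. M n j * S j k) = (if n = k then 1 else 0)) \<and>
     (\<forall>n\<ge>1. \<forall>k\<ge>1. (\<Sum>j=1..n. S n j * M j k) = (if n = k then 1 else 0))"

text \<open>The infinite sum is a limit in the metric topology of formal power series.\<close>

definition lambert_series :: "nat \<Rightarrow> nat \<Rightarrow> (nat \<Rightarrow> complex) \<Rightarrow> complex fps" where
  "lambert_series \<alpha> \<beta> a =
     (\<Sum>i. let n = Suc i in
        fps_const (a n) * fps_X ^ (\<alpha> * n + \<beta>) / (1 - fps_X ^ (\<alpha> * n + \<beta>)))"

text \<open>The coefficient at \<open>q^0\<close> on the right-hand side is an empty sum.\<close>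

definition lambert_factorization ::
    "nat \<Rightarrow> nat \<Rightarrow> complex fps \<Rightarrow> (nat \<Rightarrow> nat \<Rightarrow> complex) \<Rightarrow>
     (nat \<Rightarrow> complex) \<Rightarrow> (nat \<Rightarrow> complex) \<Rightarrow> bool" where
  "lambert_factorization \<alpha> \<beta> C s a b \<longleftrightarrow>
     lambert_series \<alpha> \<beta> a = inverse C * Abs_fps (\<lambda>n. \<Sum>k=1..n. s n k * b k)"


lemma summable_lambert_series:
  assumes "\<alpha> \<ge> 1"
  shows "summable (\<lambda>i. let n = Suc i in
        fps_const (a n :: complex) * fps_X ^ (\<alpha> * n + \<beta>) / (1 - fps_X ^ (\<alpha> * n + \<beta>)))"
    (is "summable ?t")
proof -
  have t: "fps_nth (?t i) m = 0" if "m \<le> i" for i m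
  proof -
    define e where "e = \<alpha> * Suc i + \<beta>"
    have "1 * Suc i \<le> \<alpha> * Suc i" using assms by (rule mult_le_mono1)
    then have "Suc i \<le> e" unfolding e_def by (metis mult_1 trans_le_add1)
    then have e: "e > m" using that by simp
    have u: "fps_nth (1 - fps_X ^ e :: complex fps) 0 \<noteq> 0" using e by simp
    have "?t i = fps_const (a (Suc i)) * (fps_X ^ e * inverse (1 - fps_X ^ e))"
      unfolding Let_def e_def[symmetric] using u by (simp add: fps_divide_unit mult.assoc)
    then show ?thesis using e by (simp add: fps_X_power_mult_nth)
  qed
  define T where "T = ?t"
  have T: "fps_nth (T i) m = 0" if "m \<le> i" for i m
    unfolding T_def by (rule t[OF that])
  have stable: "fps_nth (\<Sum>i<k. T i) m = (\<Sum>i\<le>m. fps_nth (T i) m)" if "k > m" for k m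
    unfolding fps_sum_nth using that
    by (intro sum.mono_neutral_right) (auto intro!: T)
  have "T sums Abs_fps (\<lambda>m. \<Sum>i\<le>m. fps_nth (T i) m)"
    unfolding sums_def
  proof (rule tendsto_fpsI)
    fix m
    show "\<forall>\<^sub>F k in sequentially. fps_nth (\<Sum>i<k. T i) m
        = fps_nth (Abs_fps (\<lambda>m. \<Sum>i\<le>m. fps_nth (T i) m)) m"
      using eventually_gt_at_top[of m]
      by eventually_elim (simp only: stable fps_nth_Abs_fps)
  qed
  then show ?thesis unfolding T_def by (rule sums_summable)
qed

fun lt_right_inv :: "(nat \<Rightarrow> nat \<Rightarrow> complex) \<Rightarrow> nat \<Rightarrow> nat \<Rightarrow> complex" where
  "lt_right_inv M n k =
     ((if n = k then 1 else 0) - (\<Sum>j\<in>{1..<n}. M n j * lt_right_inv M j k)) / M n n"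

declare lt_right_inv.simps [simp del]

lemma lt_right_inv_lower:
  assumes "k > n" shows "lt_right_inv M n k = 0"
  using assms
proof (induction n rule: less_induct)
  case (less n)
  then have "(\<Sum>j\<in>{1..<n}. M n j * lt_right_inv M j k) = 0"
    by (intro sum.neutral) auto
  then show ?case using less.prems by (simp add: lt_right_inv.simps[of M n])
qed

lemma lt_right_inv_diag: "lt_right_inv M n n = 1 / M n n"
proof -
  have "(\<Sum>j\<in>{1..<n}. M n j * lt_right_inv M j n) = 0"
    by (intro sum.neutral) (auto simp: lt_right_inv_lower)
  then show ?thesis by (simp add: lt_right_inv.simps[of M n])
qed

lemma lt_right_inv:
  assumes "M n n \<noteq> 0" "n \<ge> 1"
  shows "(\<Sum>j=1..n. M n j * lt_right_inv M j k) = (if n = k then 1 else 0)"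
proof -
  have "{1..n} = insert n {1..<n}" using assms by auto
  then have "(\<Sum>j=1..n. M n j * lt_right_inv M j k)
      = M n n * lt_right_inv M n k + (\<Sum>j\<in>{1..<n}. M n j * lt_right_inv M j k)"
    by simp
  then show ?thesis using assms by (simp add: lt_right_inv.simps[of M n])
qed

lemma lt_inverse_unique:
  assumes L: "lower_triangular A"
    and AB: "\<forall>n\<ge>1. \<forall>k\<ge>1. (\<Sum>j=1..n. A n j * B j k) = (if n = k then 1 else 0)"
    and BC: "\<forall>n\<ge>1. \<forall>k\<ge>1. (\<Sum>j=1..n. B n j * C j k) = (if n = k then 1 else 0)"
    and B: "lower_triangular B"
    and n: "n \<ge> 1" and k: "k \<ge> 1"
  shows "A n k = C n k"
proof -
  have "C n k = (\<Sum>i=1..n. (if n = i then 1 else 0) * C i k)"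
    using n by (simp add: if_distrib[of "\<lambda>x. x * _"] cong: if_cong)
  also have "\<dots> = (\<Sum>i=1..n. (\<Sum>j=1..n. A n j * B j i) * C i k)"
    using AB n by (intro sum.cong) auto
  also have "\<dots> = (\<Sum>j=1..n. A n j * (\<Sum>i=1..n. B j i * C i k))"
    unfolding sum_distrib_left sum_distrib_right
    by (subst sum.swap) (simp add: mult.assoc)
  also have "\<dots> = (\<Sum>j=1..n. A n j * (\<Sum>i=1..j. B j i * C i k))"
    using B by (intro sum.cong refl arg_cong2[of _ _ _ _ "(*)"] sum.mono_neutral_right)
      (auto simp: lower_triangular_def)
  also have "\<dots> = (\<Sum>j=1..n. A n j * (if j = k then 1 else 0))"
    using BC k by (intro sum.cong) auto
  also have "\<dots> = A n k"
    using L n k by (auto simp: lower_triangular_def if_distrib[of "\<lambda>x. _ * x"] cong: if_cong)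
  finally show ?thesis by simp
qed

lemma inverse_lt_matrix_exists:
  assumes L: "lower_triangular M" and D: "\<forall>n\<ge>1. M n n \<noteq> 0"
  shows "inverse_lt_matrix M (lt_right_inv M)"
proof -
  define S where "S = lt_right_inv M"
  define Z where "Z = lt_right_inv S"
  have SL: "lower_triangular S" and DS: "\<forall>n\<ge>1. S n n \<noteq> 0"
    using D by (auto simp: S_def lower_triangular_def lt_right_inv_lower lt_right_inv_diag)
  have MS: "\<forall>n\<ge>1. \<forall>k\<ge>1. (\<Sum>j=1..n. M n j * S j k) = (if n = k then 1 else 0)"
    unfolding S_def using D by (blast intro: lt_right_inv)
  have SZ: "\<forall>n\<ge>1. \<forall>k\<ge>1. (\<Sum>j=1..n. S n j * Z j k) = (if n = k then 1 else 0)"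
    unfolding Z_def using DS by (blast intro: lt_right_inv)
  have eq: "M n k = Z n k" if "n \<ge> 1" "k \<ge> 1" for n k
    using lt_inverse_unique[OF L MS SZ SL that] .
  have "(\<Sum>j=1..n. S n j * M j k) = (\<Sum>j=1..n. S n j * Z j k)" if "k \<ge> 1" for n k
    using that by (intro sum.cong) (auto simp: eq)
  then show ?thesis
    using L SL MS SZ by (simp add: inverse_lt_matrix_def flip: S_def)
qed

lemma inverse_lt_matrix_unique:
  assumes "inverse_lt_matrix M S" "inverse_lt_matrix M T" "n \<ge> 1" "k \<ge> 1"
  shows "S n k = T n k"
  using assms lt_inverse_unique[of S M T n k] by (simp add: inverse_lt_matrix_def)

lemma s_inv_lower_triangular: "lower_triangular (s_inv C \<gamma>)"
  unfolding lower_triangular_def s_inv_def qcoeff_def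
  by (auto intro!: sum.neutral dest!: dvd_imp_le)

lemma s_inv_diag:
  assumes "n \<ge> 1"
  shows "s_inv C \<gamma> n n = inverse (fps_nth C 0) * \<gamma> 1"
proof -
  have "s_inv C \<gamma> n n = (\<Sum>d\<in>{n}. qcoeff (int d - int n) (inverse C) * \<gamma> (n div d))"
    unfolding s_inv_def using assms
    by (intro sum.mono_neutral_right) (auto simp: qcoeff_def dest!: dvd_imp_le)
  then show ?thesis using assms by (simp add: qcoeff_def)
qed

lemma s_inv_inverse_exists:
  assumes "fps_nth C 0 \<noteq> 0" "\<gamma> 1 \<noteq> 0"
  shows "\<exists>s. inverse_lt_matrix (s_inv C \<gamma>) s"
proof -
  have "\<forall>n\<ge>1. s_inv C \<gamma> n n \<noteq> 0" using assms by (simp add: s_inv_diag)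
  then show ?thesis using inverse_lt_matrix_exists[OF s_inv_lower_triangular] by blast
qed

end

theory Submission
  imports Defs
begin

text \<open>
  Write \<open>L\<close> for the Lambert series and \<open>l\<^sub>n = [q^n] L\<close>, which is the sum of
  \<open>a\<^sub>(\<^sub>d\<^sub>-\<^sub>\<beta>\<^sub>)\<^sub>/\<^sub>\<alpha>\<close> over the admissible divisors \<open>d\<close> of \<open>n\<close>.
  Inverting the matrix \<open>s\<close>, the factorization says that \<open>b\<close> is the image under
  \<open>s\<^sup>-\<^sup>1\<close> of the coefficient sequence of \<open>C L\<close>. By its definition, \<open>s\<^sup>-\<^sup>1\<close>
  first divides by \<open>C\<close> and then takes the Dirichlet convolution with \<open>\<gamma>\<close>, so
  \<open>b\<close> is the convolution of \<open>l\<close> with \<open>\<gamma>\<close>, and the formula follows by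
  associativity of the Dirichlet convolution.
\<close>

text \<open>A geometric series that starts at exponent \<open>e\<close>: multiplying the candidate
  \<open>G\<close> by \<open>1 - fps_X ^ e\<close> subtracts its shift by \<open>e\<close>, so
  everything cancels except \<open>c\<close> at exponent \<open>e\<close>, where the shifted
  coefficient is the zero at index 0.\<close>

lemma fps_X_power_divide_one_minus_nth:
  fixes c :: complex
  assumes "e > 0"
  shows "fps_nth (fps_const c * fps_X ^ e / (1 - fps_X ^ e)) m =
    (if m > 0 \<and> e dvd m then c else 0)"
proof -
  define G :: "complex fps" where "G = Abs_fps (\<lambda>m. if m > 0 \<and> e dvd m then c else 0)"
  have unit: "fps_nth (1 - fps_X ^ e :: complex fps) 0 \<noteq> 0"
    using assms by simp
  have "G * (1 - fps_X ^ e) = fps_const c * fps_X ^ e"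
  proof (rule fps_ext)
    fix m
    have "e dvd m - e \<longleftrightarrow> e dvd m" if "e \<le> m"
      using that by (simp add: dvd_minus_self)
    moreover have "\<not> e dvd m" if "0 < m" "m < e"
      using that by (simp add: nat_dvd_not_less)
    ultimately show "fps_nth (G * (1 - fps_X ^ e)) m = fps_nth (fps_const c * fps_X ^ e) m"
      using assms
      by (cases m e rule: linorder_cases)
        (auto simp: G_def algebra_simps fps_X_power_mult_nth)
  qed
  then have "fps_const c * fps_X ^ e / (1 - fps_X ^ e) = G"
    using unit by (metis fps_nonzeroI nonzero_mult_div_cancel_right)
  then show ?thesis by (simp add: G_def)
qed

text \<open>The exponent of the term with index \<open>i\<close> exceeds \<open>i\<close>, so only
  the terms with \<open>i < m\<close> reach the coefficient of index \<open>m\<close>. Each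
  contributes \<open>a (Suc i)\<close> exactly when its exponent divides \<open>m\<close>, and these
  exponents are the admissible divisors.\<close>

lemma lambert_series_nth:
  assumes "\<alpha> \<ge> 1"
  shows "fps_nth (lambert_series \<alpha> \<beta> a) m = (if m = 0 then 0 else
    (\<Sum>d | d dvd m \<and> d > \<beta> \<and> [d = \<beta>] (mod \<alpha>). a ((d - \<beta>) div \<alpha>)))"
proof -
  define T where "T = (\<lambda>i. let n = Suc i in
        fps_const (a n) * fps_X ^ (\<alpha> * n + \<beta>) / (1 - fps_X ^ (\<alpha> * n + \<beta>)))"
  define e where "e = (\<lambda>i. \<alpha> * Suc i + \<beta>)"
  have e_gt: "e i > i" for i
  proof -
    have "1 * Suc i \<le> \<alpha> * Suc i" using assms by (rule mult_le_mono1)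
    then show ?thesis by (simp add: e_def)
  qed
  have T_nth: "fps_nth (T i) m = (if m > 0 \<and> e i dvd m then a (Suc i) else 0)" for i m
    unfolding T_def Let_def e_def
    using e_gt[of i] by (subst fps_X_power_divide_one_minus_nth) (auto simp: e_def)
  have T_zero: "fps_nth (T i) m = 0" if "m \<le> i" for i m
    using that e_gt[of i] by (auto simp: T_nth dest!: dvd_imp_le)
  have "T sums Abs_fps (\<lambda>m. \<Sum>i<m. fps_nth (T i) m)"
    unfolding sums_def
  proof (rule tendsto_fpsI)
    fix m
    show "\<forall>\<^sub>F k in sequentially. fps_nth (\<Sum>i<k. T i) m
        = fps_nth (Abs_fps (\<lambda>m. \<Sum>i<m. fps_nth (T i) m)) m"
      using eventually_ge_at_top[of m]
      by eventually_elim
        (auto simp: fps_sum_nth intro!: sum.mono_neutral_right T_zero)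
  qed
  moreover have "lambert_series \<alpha> \<beta> a = suminf T"
    by (simp add: lambert_series_def T_def)
  ultimately have nth: "fps_nth (lambert_series \<alpha> \<beta> a) m = (\<Sum>i<m. fps_nth (T i) m)"
    by (simp add: sums_iff)
  show ?thesis
  proof (cases "m = 0")
    case False
    have "(\<Sum>i<m. fps_nth (T i) m) = (\<Sum>i | i < m \<and> e i dvd m. a (Suc i))"
      using False by (auto simp: T_nth sum.If_cases intro!: sum.cong)
    also have "\<dots> = (\<Sum>d | d dvd m \<and> d > \<beta> \<and> [d = \<beta>] (mod \<alpha>). a ((d - \<beta>) div \<alpha>))"
    \<comment> \<open>Solving \<open>d = \<alpha> * Suc i + \<beta>\<close> for \<open>i\<close>;
      the quotient is positive because \<open>d > \<beta>\<close>, so the truncated subtraction of 1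
      is exact.\<close>
    proof (rule sum.reindex_bij_witness[where j = e and i = "\<lambda>d. (d - \<beta>) div \<alpha> - 1"])
      fix d assume d: "d \<in> {d. d dvd m \<and> d > \<beta> \<and> [d = \<beta>] (mod \<alpha>)}"
      then have "\<alpha> dvd d - \<beta>"
        by (auto simp: cong_altdef_nat)
      then obtain k where k: "d - \<beta> = \<alpha> * k" by blast
      with d have "k > 0" by (cases k) auto
      then show e_d: "e ((d - \<beta>) div \<alpha> - 1) = d"
        using k d assms by (cases k) (auto simp: e_def)
      then show "(d - \<beta>) div \<alpha> - 1 \<in> {i. i < m \<and> e i dvd m}"
        using d False e_gt[of "(d - \<beta>) div \<alpha> - 1"] dvd_imp_le[of d m] by auto
    qed (use assms in \<open>auto simp: e_def cong_def mod_mult_self4 simp del: mult_Suc_right\<close>)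
    finally show ?thesis using False by (simp add: nth)
  qed (use nth in simp)
qed

text \<open>Both sides compute the convolution of \<open>h\<close>, the constant 1 and
  \<open>\<gamma>\<close>: they sum \<open>h e * \<gamma> c\<close> over all \<open>e\<close> and
  \<open>c\<close> whose product divides \<open>n\<close>.\<close>

lemma dirichlet_convolution_divisor_sum:
  fixes h \<gamma> :: "nat \<Rightarrow> complex"
  assumes "n \<ge> 1"
  shows "(\<Sum>d | d dvd n. divisor_sum h d * \<gamma> (n div d)) =
    (\<Sum>d | d dvd n. h d * divisor_sum \<gamma> (n div d))"
proof -
  have fin: "finite {d. d dvd m}" if "m dvd n" for m
    using that assms by (intro finite_divisors_nat) (auto intro: Nat.gr0I)
  have "(\<Sum>d | d dvd n. divisor_sum h d * \<gamma> (n div d)) =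
      (\<Sum>(d, e) \<in> Sigma {d. d dvd n} (\<lambda>d. {e. e dvd d}). h e * \<gamma> (n div d))"
    using fin by (simp add: divisor_sum_def sum_distrib_right sum.Sigma)
  also have "\<dots> = (\<Sum>(e, c) \<in> Sigma {e. e dvd n} (\<lambda>e. {c. c dvd n div e}). h e * \<gamma> c)"
    \<comment> \<open>A chain in which \<open>e\<close> divides \<open>d\<close> and
      \<open>d\<close> divides \<open>n\<close> is recorded by \<open>e\<close> and the cofactor
      \<open>c = n div d\<close>.\<close>
    by (rule sum.reindex_bij_witness
        [where j = "\<lambda>(d, e). (e, n div d)" and i = "\<lambda>(e, c). (n div c, e)"])
      (use assms in \<open>auto elim!: dvdE\<close>)
  also have "\<dots> = (\<Sum>d | d dvd n. h d * divisor_sum \<gamma> (n div d))"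
    unfolding divisor_sum_def sum_distrib_left
    by (rule sum.Sigma[symmetric]) (use fin in \<open>auto elim!: dvdE\<close>)
  finally show ?thesis .
qed

text \<open>After exchanging the sums over \<open>k\<close> and \<open>d\<close>, the inner sum over
  \<open>k\<close> is the Cauchy product for coefficient \<open>d\<close> of
  \<open>inverse C * P\<close>.\<close>

lemma sum_s_inv_mult_nth:
  assumes "n \<ge> 1" "fps_nth P 0 = 0"
  shows "(\<Sum>k=1..n. s_inv C \<gamma> n k * fps_nth P k) =
    (\<Sum>d | d dvd n. fps_nth (inverse C * P) d * \<gamma> (n div d))"
proof -
  have conv: "(\<Sum>k=1..n. qcoeff (int d - int k) (inverse C) * fps_nth P k) =
      fps_nth (inverse C * P) d" if "d dvd n" for d
  proof -
    have "d \<le> n" using that assms by (simp add: dvd_imp_le)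
    then have "(\<Sum>k=1..n. qcoeff (int d - int k) (inverse C) * fps_nth P k) =
        (\<Sum>k=1..d. qcoeff (int d - int k) (inverse C) * fps_nth P k)"
      \<comment> \<open>For \<open>k > d\<close> the index \<open>int d - int k\<close> is negative,
        where \<open>qcoeff\<close> is 0.\<close>
      by (intro sum.mono_neutral_right) (auto simp: qcoeff_def)
    also have "\<dots> = (\<Sum>k=0..d. qcoeff (int d - int k) (inverse C) * fps_nth P k)"
      \<comment> \<open>The Cauchy product starts at \<open>k = 0\<close>; that term is harmless
        since \<open>P\<close> has constant coefficient 0.\<close>
      using assms by (intro sum.mono_neutral_left) (auto simp: not_less_eq_eq)
    also have "\<dots> = (\<Sum>k=0..d. fps_nth P k * fps_nth (inverse C) (d - k))"
      by (intro sum.cong) (auto simp: qcoeff_def nat_diff_distrib)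
    also have "\<dots> = fps_nth (inverse C * P) d"
      by (subst mult.commute) (simp add: fps_mult_nth)
    finally show ?thesis .
  qed
  have "(\<Sum>d | d dvd n. fps_nth (inverse C * P) d * \<gamma> (n div d)) =
      (\<Sum>d | d dvd n. \<Sum>k=1..n. qcoeff (int d - int k) (inverse C) * \<gamma> (n div d) * fps_nth P k)"
  proof (intro sum.cong refl)
    fix d assume "d \<in> {d. d dvd n}"
    then have "fps_nth (inverse C * P) d * \<gamma> (n div d) =
        (\<Sum>k=1..n. qcoeff (int d - int k) (inverse C) * fps_nth P k) * \<gamma> (n div d)"
      by (simp only: conv mem_Collect_eq)
    also have "\<dots> = (\<Sum>k=1..n. qcoeff (int d - int k) (inverse C) * \<gamma> (n div d) * fps_nth P k)"
      unfolding sum_distrib_right by (simp only: mult_ac)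
    finally show "fps_nth (inverse C * P) d * \<gamma> (n div d) = \<dots>" .
  qed
  also have "\<dots> = (\<Sum>k=1..n. s_inv C \<gamma> n k * fps_nth P k)"
    by (subst sum.swap) (simp add: s_inv_def sum_distrib_right)
  finally show ?thesis by simp
qed

lemma inverse_lt_matrix_sym: "inverse_lt_matrix M S \<Longrightarrow> inverse_lt_matrix S M"
  by (simp add: inverse_lt_matrix_def)

text \<open>Lower triangularity of \<open>S\<close> allows every inner sum to run up to the common
  bound \<open>n\<close>, so the sums can be exchanged and the product of \<open>M\<close> and
  \<open>S\<close> collapses to the identity.\<close>

lemma inverse_lt_matrix_mult_cancel:
  assumes inv: "inverse_lt_matrix M S" and n: "n \<ge> 1"
    and p: "\<And>n. n \<ge> 1 \<Longrightarrow> p n = (\<Sum>k=1..n. S n k * b k)"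
  shows "(\<Sum>k=1..n. M n k * p k) = b n"
proof -
  have "(\<Sum>k=1..n. M n k * p k) = (\<Sum>k=1..n. M n k * (\<Sum>j=1..n. S k j * b j))"
  proof (intro sum.cong refl)
    fix k assume k: "k \<in> {1..n}"
    have "(\<Sum>j=1..k. S k j * b j) = (\<Sum>j=1..n. S k j * b j)"
      using inv k by (intro sum.mono_neutral_left)
        (auto simp: inverse_lt_matrix_def lower_triangular_def)
    then show "M n k * p k = M n k * (\<Sum>j=1..n. S k j * b j)"
      using k by (simp add: p)
  qed
  also have "\<dots> = (\<Sum>j=1..n. (\<Sum>k=1..n. M n k * S k j) * b j)"
    unfolding sum_distrib_left sum_distrib_right
    by (subst sum.swap) (simp add: mult.assoc)
  also have "\<dots> = (\<Sum>j=1..n. (if n = j then 1 else 0) * b j)"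
    using inv n by (intro sum.cong) (auto simp: inverse_lt_matrix_def)
  also have "\<dots> = b n"
    using n by (simp add: if_distrib[of "\<lambda>x. x * _"] cong: if_cong)
  finally show ?thesis .
qed

lemma inverse_lt_matrix_mult_eq_iff:
  assumes "inverse_lt_matrix M S"
  shows "(\<forall>n\<ge>1. p n = (\<Sum>k=1..n. S n k * b k)) \<longleftrightarrow>
    (\<forall>n\<ge>1. b n = (\<Sum>k=1..n. M n k * p k))"
  using inverse_lt_matrix_mult_cancel[OF assms, of _ p b]
    inverse_lt_matrix_mult_cancel[OF inverse_lt_matrix_sym[OF assms], of _ b p]
  by metis

text \<open>An equivalence rather than an implication, so that existence, uniqueness and the value
  of the sequence all follow from it.\<close>

lemma lambert_factorization_iff:
  assumes "\<alpha> \<ge> 1" "fps_nth C 0 \<noteq> 0" "inverse_lt_matrix (s_inv C \<gamma>) s"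
  shows "lambert_factorization \<alpha> \<beta> C s a b \<longleftrightarrow>
    (\<forall>n\<ge>1. b n = (\<Sum>d | d dvd n \<and> d > \<beta> \<and> [d = \<beta>] (mod \<alpha>).
       a ((d - \<beta>) div \<alpha>) * divisor_sum \<gamma> (n div d)))"
proof -
  define L where "L = lambert_series \<alpha> \<beta> a"
  \<comment> \<open>Extending by zero turns the restricted sum into a plain divisor sum, to which
    associativity of convolution applies.\<close>
  define h where "h = (\<lambda>d. if d > \<beta> \<and> [d = \<beta>] (mod \<alpha>) then a ((d - \<beta>) div \<alpha>) else 0)"
  have L_nth: "fps_nth L m = (if m = 0 then 0 else divisor_sum h m)" for m
  proof (cases "m = 0")
    case False
    then have "divisor_sum h m =
        (\<Sum>d | d dvd m \<and> d > \<beta> \<and> [d = \<beta>] (mod \<alpha>). a ((d - \<beta>) div \<alpha>))"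
      unfolding divisor_sum_def
      by (intro sum.mono_neutral_cong_right) (auto simp: h_def)
    then show ?thesis
      using False by (simp add: L_def lambert_series_nth[OF assms(1)])
  qed (simp add: L_def lambert_series_nth[OF assms(1)])
  have unit: "inverse C * C = 1"
    using assms(2) by (rule inverse_mult_eq_1)
  have CL0: "fps_nth (C * L) 0 = 0"
    by (simp add: L_nth)
  have LCL: "inverse C * (C * L) = L"
    using unit by (simp add: mult.assoc[symmetric])
  have image: "(\<Sum>k=1..n. s_inv C \<gamma> n k * fps_nth (C * L) k) =
      (\<Sum>d | d dvd n \<and> d > \<beta> \<and> [d = \<beta>] (mod \<alpha>).
         a ((d - \<beta>) div \<alpha>) * divisor_sum \<gamma> (n div d))" if n: "n \<ge> 1" for n
  proof -
    have "(\<Sum>k=1..n. s_inv C \<gamma> n k * fps_nth (C * L) k) =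
        (\<Sum>d | d dvd n. divisor_sum h d * \<gamma> (n div d))"
      unfolding sum_s_inv_mult_nth[OF n CL0] LCL
      using n by (intro sum.cong) (auto simp: L_nth)
    also have "\<dots> = (\<Sum>d | d dvd n. h d * divisor_sum \<gamma> (n div d))"
      using n by (rule dirichlet_convolution_divisor_sum)
    also have "\<dots> = (\<Sum>d | d dvd n \<and> d > \<beta> \<and> [d = \<beta>] (mod \<alpha>).
         a ((d - \<beta>) div \<alpha>) * divisor_sum \<gamma> (n div d))"
      using n by (intro sum.mono_neutral_cong_right) (auto simp: h_def)
    finally show ?thesis .
  qed
  have "lambert_factorization \<alpha> \<beta> C s a b \<longleftrightarrow>
      C * L = Abs_fps (\<lambda>n. \<Sum>k=1..n. s n k * b k)"
    unfolding lambert_factorization_def L_def[symmetric]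
  proof
    assume "L = inverse C * Abs_fps (\<lambda>n. \<Sum>k=1..n. s n k * b k)"
    then have "C * L = (inverse C * C) * Abs_fps (\<lambda>n. \<Sum>k=1..n. s n k * b k)"
      by (simp only: mult_ac)
    then show "C * L = Abs_fps (\<lambda>n. \<Sum>k=1..n. s n k * b k)"
      by (simp only: unit mult_1)
  next
    assume "C * L = Abs_fps (\<lambda>n. \<Sum>k=1..n. s n k * b k)"
    then show "L = inverse C * Abs_fps (\<lambda>n. \<Sum>k=1..n. s n k * b k)"
      using LCL by simp
  qed
  also have "\<dots> \<longleftrightarrow> (\<forall>n\<ge>1. fps_nth (C * L) n = (\<Sum>k=1..n. s n k * b k))"
  proof -
    \<comment> \<open>At index 0 both sides vanish, the right one as an empty sum, so comparing the
      series only constrains \<open>n \<ge> 1\<close>.\<close>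
    have "fps_nth (C * L) n = (\<Sum>k=1..n. s n k * b k)" if "\<not> n \<ge> 1" for n
      using that CL0 by (cases n) auto
    then show ?thesis
      unfolding fps_eq_iff fps_nth_Abs_fps by blast
  qed
  also have "\<dots> \<longleftrightarrow> (\<forall>n\<ge>1. b n = (\<Sum>k=1..n. s_inv C \<gamma> n k * fps_nth (C * L) k))"
    using assms(3) by (rule inverse_lt_matrix_mult_eq_iff)
  finally show ?thesis by (simp only: image cong: imp_cong)
qed

theorem theorem3p1:
  fixes \<alpha> \<beta> :: nat
    and C :: "complex fps"
    and \<gamma> :: "nat \<Rightarrow> complex"
    and s :: "nat \<Rightarrow> nat \<Rightarrow> complex"
    and a :: "nat \<Rightarrow> complex"
  assumes "\<alpha> \<ge> 1"
    and "\<beta> < \<alpha>"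
    and "fps_nth C 0 \<noteq> 0"
    and "\<gamma> 1 \<noteq> 0"
    and "inverse_lt_matrix (s_inv C \<gamma>) s"
  shows "\<exists>abar :: nat \<Rightarrow> complex.
           lambert_factorization \<alpha> \<beta> C s a abar \<and>
           (\<forall>b. lambert_factorization \<alpha> \<beta> C s a b \<longrightarrow> (\<forall>n\<ge>1. b n = abar n)) \<and>
           (\<forall>n\<ge>1. abar n =
              (\<Sum>d | d dvd n \<and> d > \<beta> \<and> [d = \<beta>] (mod \<alpha>).
                 a ((d - \<beta>) div \<alpha>) * divisor_sum \<gamma> (n div d)))"
  unfolding lambert_factorization_iff[OF assms(1,3,5)]
  \<comment> \<open>The explicit formula itself is the witness.\<close>
  by (rule exI[of _ "\<lambda>n. \<Sum>d | d dvd n \<and> d > \<beta> \<and> [d = \<beta>] (mod \<alpha>).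
       a ((d - \<beta>) div \<alpha>) * divisor_sum \<gamma> (n div d)"]) simp

end
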